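(* Let $R$ be a unital commutative ring. Let $a\in R$ be such that $a^n\not\in Ra^{n+1}$ for all integers $n\ge 0$, where $a^0=1$. Then $$\{\mathrm{rk}(a): \mathrm{rk}\in \mathbb{P}(R), \mathrm{rk}(a^2)=0\}=[0, 1/2].$$
   Context: $M(R)$ is the set of all rectangular matrices over $R$ (elements of $R$ are viewed as $1\times1$ matrices), and unital rings are nonzero. $\mathbb{P}(R)$ is the set of all Sylvester matrix rank functions for $R$, i.e. functions $\mathrm{rk}:M(R)\to\mathbb{R}_{\ge0}$ such that (i) $\mathrm{rk}(0)=0$ (for every zero matrix) and $\mathrm{rk}(1)=1$; (ii) $\mathrm{rk}(AB)\le\min(\mathrm{rk}(A),\mathrm{rk}(B))$ whenever $AB$ is defined; (iii) $\mathrm{rk}\left(\begin{bmatrix}A&0\\0&B\end{bmatrix}\right)=\mathrm{rk}(A)+\mathrm{rk}(B)$; (iv) $\mathrm{rk}\left(\begin{bmatrix}A&C\\0&B\end{bmatrix}\right)\ge\mathrm{rk}(A)+\mathrm{rk}(B)$. *)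

theory Defs
  imports Complex_Main "HOL-Library.FuncSet" "Jordan_Normal_Form.Matrix"
begin

text \<open>The type of matrices in \<^theory>\<open>Jordan_Normal_Form.Matrix\<close> also contains matrices
  without rows or columns; \<open>rect_mats\<close> is the set $M(R)$ of matrices of positive size.\<close>

definition rect_mats :: "'a mat set" where
  "rect_mats = {A. 0 < dim_row A \<and> 0 < dim_col A}"

definition elem_mat :: "'a \<Rightarrow> 'a mat" where
  "elem_mat x = mat 1 1 (\<lambda>_. x)"

text \<open>Rank functions are total HOL functions; their values outside \<open>rect_mats\<close> are
  unconstrained and irrelevant.\<close>

definition sylvester_rank_functions :: "('a::ring_1 mat \<Rightarrow> real) set" where
  "sylvester_rank_functions = {rk \<in> rect_mats \<rightarrow> {0..}.
     (\<forall>m>0. \<forall>n>0. rk (0\<^sub>m m n) = 0) \<and>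
     rk (elem_mat 1) = 1 \<and>
     (\<forall>A\<in>rect_mats. \<forall>B\<in>rect_mats. dim_col A = dim_row B \<longrightarrow>
        rk (A * B) \<le> min (rk A) (rk B)) \<and>
     (\<forall>A\<in>rect_mats. \<forall>B\<in>rect_mats.
        rk (four_block_mat A (0\<^sub>m (dim_row A) (dim_col B)) (0\<^sub>m (dim_row B) (dim_col A)) B)
          = rk A + rk B) \<and>
     (\<forall>A\<in>rect_mats. \<forall>B\<in>rect_mats. \<forall>C\<in>carrier_mat (dim_row A) (dim_col B).
        rk (four_block_mat A C (0\<^sub>m (dim_row B) (dim_col A)) B) \<ge> rk A + rk B)}"

end

theory Submission
  imports Defs "Jordan_Normal_Form.Determinant"
begin

text \<open>The bound \<open>1/2\<close>: the matrix with rows \<open>(a, 1)\<close>, \<open>(0, a)\<close> has rank at least \<open>2 rk a\<close>, and it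
  factors through \<open>diag(1, a\<^sup>2)\<close>, whose rank is \<open>1\<close>.

  For the converse, the hypothesis says that \<open>a\<close> stays a non-unit non-zero-divisor modulo its
  power torsion, so for every \<open>0 < b < 1\<close> there are ultrametric submultiplicative seminorms
  bounded by \<open>1\<close> in which multiplication by \<open>a\<close> scales by exactly \<open>b\<close>. As in Berkovich's
  theorem, a minimal one is multiplicative. A multiplicative seminorm \<open>N\<close> yields the rank
  function sending \<open>A\<close> to the supremum of \<open>k + ln (N d)\<close> over all \<open>k\<close>-minors \<open>d\<close> of
  \<open>A\<close> with \<open>N d > 0\<close>; its value at \<open>a\<close> is \<open>1 + ln b\<close>, and its value at \<open>a\<^sup>2\<close> vanishes as soon as
  \<open>ln b \<le> -1/2\<close>.\<close>

section \<open>Infima of families of nonnegative reals\<close>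

text \<open>The infimum over \<open>K\<close> lies below every product \<open>f i * g j\<close>.
  Dividing by one factor at a time lets the infimum be taken in the other; a factor that is zero is
  treated apart. The witness in \<open>K\<close> may depend on \<open>i\<close> and
  \<open>j\<close>, which is how submultiplicativity passes to seminorms defined as infima.\<close>

lemma INF_le_mult:
  fixes f :: "'i \<Rightarrow> real" and g :: "'j \<Rightarrow> real" and h :: "'k \<Rightarrow> real"
  assumes "I \<noteq> {}" "J \<noteq> {}"
    and "\<And>i. i \<in> I \<Longrightarrow> 0 \<le> f i" "\<And>j. j \<in> J \<Longrightarrow> 0 \<le> g j" "\<And>k. k \<in> K \<Longrightarrow> 0 \<le> h k"
    and le: "\<And>i j. i \<in> I \<Longrightarrow> j \<in> J \<Longrightarrow> \<exists>k\<in>K. h k \<le> f i * g j"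
  shows "(INF k\<in>K. h k) \<le> (INF i\<in>I. f i) * (INF j\<in>J. g j)"
proof -
  let ?c = "INF k\<in>K. h k"
  have bdd: "bdd_below (h ` K)"
    using assms(5) by (meson bdd_belowI2)
  have f0: "0 \<le> (INF i\<in>I. f i)"
    using assms(1,3) by (rule cINF_greatest)
  have "?c \<le> f i * (INF j\<in>J. g j)" if i: "i \<in> I" for i
  proof -
    have c: "?c \<le> f i * g j" if j: "j \<in> J" for j
      using le[OF i j] cINF_lower[OF bdd] by (meson order_trans)
    show ?thesis
    proof (cases "f i = 0")
      case True
      then show ?thesis using c assms(2) by auto
    next
      case False
      then have "0 < f i" using assms(3)[OF i] by simp
      then have "?c / f i \<le> (INF j\<in>J. g j)"
        using c by (intro cINF_greatest assms(2)) (simp add: field_simps)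
      then show ?thesis using \<open>0 < f i\<close> by (simp add: field_simps)
    qed
  qed
  note c = this
  have g0: "0 \<le> (INF j\<in>J. g j)"
    using assms(2,4) by (rule cINF_greatest)
  show ?thesis
  proof (cases "(INF j\<in>J. g j) = 0")
    case True
    then show ?thesis using c assms(1) by auto
  next
    case False
    then have pos: "0 < (INF j\<in>J. g j)" using g0 by simp
    then have "?c / (INF j\<in>J. g j) \<le> (INF i\<in>I. f i)"
      using c by (intro cINF_greatest assms(1)) (simp add: field_simps)
    then show ?thesis using pos by (simp add: field_simps)
  qed
qed

lemma INF_le_cmult:
  fixes f :: "'i \<Rightarrow> real" and g :: "'j \<Rightarrow> real"
  assumes "I \<noteq> {}" "\<And>i. i \<in> I \<Longrightarrow> 0 \<le> f i" "\<And>j. j \<in> J \<Longrightarrow> 0 \<le> g j" "0 \<le> c"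
    and "\<And>i. i \<in> I \<Longrightarrow> \<exists>j\<in>J. g j \<le> c * f i"
  shows "(INF j\<in>J. g j) \<le> c * (INF i\<in>I. f i)"
  using INF_le_mult[of "{()}" I "\<lambda>_. c" f J g] assms by simp

text \<open>A real strictly above the maximum lies above some \<open>f i\<close> and some
  \<open>g j\<close> simultaneously, hence above some \<open>h k\<close>.\<close>

lemma INF_le_max:
  fixes f :: "'i \<Rightarrow> real" and g :: "'j \<Rightarrow> real" and h :: "'k \<Rightarrow> real"
  assumes "I \<noteq> {}" "J \<noteq> {}" and nonneg: "\<And>k. k \<in> K \<Longrightarrow> 0 \<le> h k"
    and le: "\<And>i j. i \<in> I \<Longrightarrow> j \<in> J \<Longrightarrow> \<exists>k\<in>K. h k \<le> max (f i) (g j)"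
  shows "(INF k\<in>K. h k) \<le> max (INF i\<in>I. f i) (INF j\<in>J. g j)"
proof (rule dense_ge)
  fix z assume z: "max (INF i\<in>I. f i) (INF j\<in>J. g j) < z"
  then obtain i where i: "i \<in> I" "f i < z"
    using cInf_lessD[of "f ` I" z] assms(1) by auto
  moreover from z obtain j where j: "j \<in> J" "g j < z"
    using cInf_lessD[of "g ` J" z] assms(2) by auto
  ultimately obtain k where k: "k \<in> K" "h k \<le> max (f i) (g j)"
    using le by blast
  have "bdd_below (h ` K)"
    using nonneg by (meson bdd_belowI2)
  then have "(INF k\<in>K. h k) \<le> h k"
    using k(1) by (rule cINF_lower)
  then show "(INF k\<in>K. h k) \<le> z"
    using k(2) i(2) j(2) by linarith
qed

lemma INF_bounds:
  fixes f :: "'i \<Rightarrow> real"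
  assumes "i \<in> I" "\<And>i. i \<in> I \<Longrightarrow> 0 \<le> f i"
  shows "0 \<le> (INF i\<in>I. f i)" "(INF i\<in>I. f i) \<le> f i"
proof -
  show "0 \<le> (INF i\<in>I. f i)"
    using assms by (intro cINF_greatest) auto
  show "(INF i\<in>I. f i) \<le> f i"
    using assms by (meson bdd_belowI2 cINF_lower)
qed

section \<open>Multiplicative seminorms\<close>

text \<open>Exact scaling of every \<open>a * x\<close>, rather than only the value
  \<open>p a = b\<close>, passes to infima of chains, to spectral seminorms and to limits of
  \<open>p (x ^ n * y) / p x ^ n\<close>. So the value at \<open>a\<close> cannot drop when these
  constructions shrink \<open>p\<close>.\<close>

definition homogeneous_seminorms :: "'a::comm_ring_1 \<Rightarrow> real \<Rightarrow> ('a \<Rightarrow> real) set" where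
  "homogeneous_seminorms a b = {p. (\<forall>x. 0 \<le> p x \<and> p x \<le> 1) \<and> p 1 = 1 \<and>
     (\<forall>x y. p (x * y) \<le> p x * p y) \<and> (\<forall>x y. p (x + y) \<le> max (p x) (p y)) \<and>
     (\<forall>x. p (a * x) = b * p x)}"

lemma homogeneous_seminormsD:
  assumes "p \<in> homogeneous_seminorms a b"
  shows "0 \<le> p x" "p x \<le> 1" "p 1 = 1" "p (x * y) \<le> p x * p y"
    "p (x + y) \<le> max (p x) (p y)" "p (a * x) = b * p x"
  using assms unfolding homogeneous_seminorms_def by auto

lemma homogeneous_seminormsI:
  assumes "\<And>x. 0 \<le> p x" "\<And>x. p x \<le> 1" "1 \<le> p 1" "\<And>x y. p (x * y) \<le> p x * p y"
    "\<And>x y. p (x + y) \<le> max (p x) (p y)" "\<And>x. p (a * x) \<le> b * p x"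
    "\<And>x. b * p x \<le> p (a * x)"
  shows "p \<in> homogeneous_seminorms a b"
  using assms unfolding homogeneous_seminorms_def by (auto intro: antisym)

lemma homogeneous_seminorm_power:
  assumes p: "p \<in> homogeneous_seminorms a b"
  shows "p (x ^ n) \<le> p x ^ n" "p (a ^ n * y) = b ^ n * p y"
proof -
  show "p (x ^ n) \<le> p x ^ n"
  proof (induction n)
    case (Suc n)
    have "p (x ^ Suc n) \<le> p x * p (x ^ n)"
      using homogeneous_seminormsD(4)[OF p] by simp
    also have "\<dots> \<le> p x * p x ^ n"
      using Suc homogeneous_seminormsD(1)[OF p] by (intro mult_left_mono)
    finally show ?case by simp
  qed (simp add: homogeneous_seminormsD[OF p])
  show "p (a ^ n * y) = b ^ n * p y"
    by (induction n arbitrary: y) (simp_all add: mult.assoc homogeneous_seminormsD(6)[OF p])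
qed

text \<open>The \<open>a\<close>-adic seminorm of the image of the ring in its localization at \<open>a\<close>.\<close>

lemma adic_seminorm:
  fixes a :: "'a::comm_ring_1"
  assumes a: "\<And>n. \<not> a ^ (n + 1) dvd a ^ n" and b: "0 < b" "b < 1"
  shows "homogeneous_seminorms a b \<noteq> {}"
proof -
  \<comment> \<open>\<open>k \<in> D x\<close> says that \<open>a ^ k\<close> divides
    \<open>x\<close> modulo elements killed by a power of \<open>a\<close>; the factor
    \<open>a ^ n\<close> absorbs that torsion. As \<open>b < 1\<close>, higher divisibility means a
    smaller value of \<open>p\<close>.\<close>
  define D where "D x = {k. \<exists>n. a ^ (n + k) dvd a ^ n * x}" for x
  define p where "p x = (INF k\<in>D x. b ^ k)" for x
  have D0: "0 \<in> D x" for x unfolding D_def by auto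
  have ne: "D x \<noteq> {}" for x using D0 by auto
  have D_mult: "k + l \<in> D (x * y)" if "k \<in> D x" "l \<in> D y" for k l x y
  proof -
    obtain n m where "a ^ (n + k) dvd a ^ n * x" "a ^ (m + l) dvd a ^ m * y"
      using \<open>k \<in> D x\<close> \<open>l \<in> D y\<close> unfolding D_def by auto
    then have "a ^ (n + k) * a ^ (m + l) dvd (a ^ n * x) * (a ^ m * y)"
      by (rule mult_dvd_mono)
    then have "a ^ ((n + m) + (k + l)) dvd a ^ (n + m) * (x * y)"
      by (simp add: power_add algebra_simps)
    then show ?thesis unfolding D_def by blast
  qed
  have D_add: "min k l \<in> D (x + y)" if "k \<in> D x" "l \<in> D y" for k l x y
  proof -
    obtain n m where n: "a ^ (n + k) dvd a ^ n * x" and m: "a ^ (m + l) dvd a ^ m * y"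
      using \<open>k \<in> D x\<close> \<open>l \<in> D y\<close> unfolding D_def by auto
    \<comment> \<open>Both divisibilities are brought to the common torsion exponent
      \<open>n + m\<close>.\<close>
    have "a ^ (n + m + min k l) dvd a ^ m * a ^ (n + k)"
      unfolding power_add[symmetric] by (rule le_imp_power_dvd) simp
    then have "a ^ (n + m + min k l) dvd a ^ (n + m) * x"
      using mult_dvd_mono[OF dvd_refl n, of "a ^ m"]
      by (metis ab_semigroup_mult_class.mult_ac(1) add.commute dvd_trans power_add)
    moreover have "a ^ (n + m + min k l) dvd a ^ n * a ^ (m + l)"
      unfolding power_add[symmetric] by (rule le_imp_power_dvd) simp
    then have "a ^ (n + m + min k l) dvd a ^ (n + m) * y"
      using mult_dvd_mono[OF dvd_refl m, of "a ^ n"]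
      by (metis ab_semigroup_mult_class.mult_ac(1) dvd_trans power_add)
    ultimately have "a ^ (n + m + min k l) dvd a ^ (n + m) * (x + y)"
      by (simp add: distrib_left)
    then show ?thesis unfolding D_def by blast
  qed
  have D_a: "Suc k \<in> D (a * x)" if "k \<in> D x" for k x
  proof -
    obtain n where "a ^ (n + k) dvd a ^ n * x"
      using \<open>k \<in> D x\<close> unfolding D_def by auto
    then have "a * a ^ (n + k) dvd a * (a ^ n * x)"
      by (rule mult_dvd_mono[OF dvd_refl])
    then have "a ^ (n + Suc k) dvd a ^ n * (a * x)"
      by (simp add: algebra_simps)
    then show ?thesis unfolding D_def by blast
  qed
  \<comment> \<open>Converse of \<open>D_a\<close>: one factor \<open>a\<close> moves from the
    argument into the torsion exponent, which grows from \<open>n\<close> to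
    \<open>Suc n\<close>.\<close>
  have D_a': "\<exists>l\<in>D x. k \<le> Suc l" if k: "k \<in> D (a * x)" for k x
  proof (cases k)
    case 0
    then show ?thesis using D0 by auto
  next
    case (Suc l)
    obtain n where "a ^ (n + k) dvd a ^ n * (a * x)"
      using k unfolding D_def by auto
    then have "a ^ (Suc n + l) dvd a ^ Suc n * x"
      by (simp add: Suc algebra_simps)
    then have "l \<in> D x" unfolding D_def by blast
    then show ?thesis using Suc by auto
  qed
  have "p \<in> homogeneous_seminorms a b"
  proof (rule homogeneous_seminormsI)
    fix x y
    show "0 \<le> p x" "p x \<le> 1"
      using INF_bounds[of 0 "D x" "\<lambda>k. b ^ k"] D0 b unfolding p_def by auto
    show "p (x * y) \<le> p x * p y"
      unfolding p_def
    proof (intro INF_le_mult ne)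
      fix k l assume "k \<in> D x" "l \<in> D y"
      then show "\<exists>i\<in>D (x * y). b ^ i \<le> b ^ k * b ^ l"
        using D_mult by (intro bexI[of _ "k + l"]) (simp_all add: power_add)
    qed (use b in auto)
    show "p (x + y) \<le> max (p x) (p y)"
      unfolding p_def
    proof (intro INF_le_max ne)
      fix k l assume kl: "k \<in> D x" "l \<in> D y"
      have "b ^ min k l \<le> max (b ^ k) (b ^ l)"
        by (simp add: min_def)
      then show "\<exists>i\<in>D (x + y). b ^ i \<le> max (b ^ k) (b ^ l)"
        using D_add[OF kl] by blast
    qed (use b in auto)
    show "p (a * x) \<le> b * p x"
      unfolding p_def
    proof (intro INF_le_cmult ne)
      fix k assume "k \<in> D x"
      then show "\<exists>i\<in>D (a * x). b ^ i \<le> b * b ^ k"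
        using D_a by (intro bexI[of _ "Suc k"]) simp_all
    qed (use b in auto)
    have "p x \<le> (1 / b) * p (a * x)"
      unfolding p_def
    proof (intro INF_le_cmult ne)
      fix k assume "k \<in> D (a * x)"
      then obtain l where l: "l \<in> D x" "k \<le> Suc l" using D_a' by blast
      then have "b ^ Suc l \<le> b ^ k" using b by (intro power_decreasing) auto
      then show "\<exists>l\<in>D x. b ^ l \<le> 1 / b * b ^ k"
        using l b by (auto simp: field_simps)
    qed (use b in auto)
    then show "b * p x \<le> p (a * x)" using b by (simp add: field_simps)
  next
    \<comment> \<open>The hypothesis on \<open>a\<close> enters here: no positive power of
      \<open>a\<close> divides 1 modulo torsion, so the seminorm of 1 does not collapse.\<close>
    have "k = 0" if k: "k \<in> D 1" for k
    proof (rule ccontr)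
      assume "k \<noteq> 0"
      from k obtain n where "a ^ (n + k) dvd a ^ n" unfolding D_def by auto
      moreover have "a ^ (n + 1) dvd a ^ (n + k)"
        by (rule le_imp_power_dvd) (use \<open>k \<noteq> 0\<close> in simp)
      ultimately show False using a dvd_trans by blast
    qed
    then have "D 1 = {0}" using D0 by auto
    then show "1 \<le> p 1" unfolding p_def by simp
  qed
  then show ?thesis by auto
qed

section \<open>Minimal homogeneous seminorms and their multiplicativity\<close>

text \<open>Zorn's lemma for the reversed pointwise order: an upper bound of a chain for
  \<open>?P\<close> is its pointwise infimum.\<close>

lemma minimal_seminorm:
  fixes a :: "'a::comm_ring_1"
  assumes ne: "homogeneous_seminorms a b \<noteq> {}" and b: "0 < b"
  obtains p where "p \<in> homogeneous_seminorms a b"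
    "\<And>q. q \<in> homogeneous_seminorms a b \<Longrightarrow> (\<And>x. q x \<le> p x) \<Longrightarrow> q = p"
proof -
  let ?A = "homogeneous_seminorms a b" and ?P = "\<lambda>p q. \<forall>x::'a. q x \<le> (p x :: real)"
  have po: "partial_order_on ?A (relation_of ?P ?A)"
  proof (rule partial_order_on_relation_ofI)
    show "?P p r" if "?P p q" "?P q r" for p q r
      using that by (meson order_trans)
    show "p = q" if "?P p q" "?P q p" for p q
      using that by (intro ext antisym) auto
  qed auto
  have "\<exists>m\<in>?A. \<forall>q\<in>?A. ?P m q \<longrightarrow> q = m"
  proof (rule predicate_Zorn[OF po])
    fix C assume C: "C \<in> Chains (relation_of ?P ?A)"
    show "\<exists>u\<in>?A. \<forall>p\<in>C. ?P p u"
    proof (cases "C = {}")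
      case True
      then show ?thesis using ne by auto
    next
      case False
      have CA: "p \<in> ?A" if "p \<in> C" for p
        using C that unfolding Chains_def relation_of_def by auto
      note D = homogeneous_seminormsD[OF CA]
      \<comment> \<open>The infima on the right-hand sides below vary over \<open>p\<close> and
        \<open>q\<close> independently, while the seminorm axioms speak of one function; a common
        lower bound in the chain reconciles the two.\<close>
      have chain: "\<exists>r\<in>C. ?P p r \<and> ?P q r" if "p \<in> C" "q \<in> C" for p q
      proof -
        have "?P p q \<or> ?P q p"
          using C that unfolding Chains_def relation_of_def by blast
        then show ?thesis using that by (metis order_refl)
      qed
      define u where "u x = (INF p\<in>C. p x)" for x
      have u_le: "u x \<le> p x" if "p \<in> C" for p x
        using INF_bounds(2)[OF that, where f = "\<lambda>p. p x"] D(1) unfolding u_def by auto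
      obtain p0 where p0: "p0 \<in> C" using False by auto
      have "u \<in> ?A"
      proof (rule homogeneous_seminormsI)
        fix x y
        show "0 \<le> u x"
          using INF_bounds(1)[OF p0, where f = "\<lambda>p. p x"] D(1) unfolding u_def by auto
        show "u x \<le> 1"
          using u_le[OF p0] D(2)[OF p0] by (rule order_trans)
        show "u (x * y) \<le> u x * u y"
          unfolding u_def
        proof (intro INF_le_mult False)
          fix p q assume "p \<in> C" "q \<in> C"
          then obtain r where r: "r \<in> C" "?P p r" "?P q r" using chain by blast
          have "r (x * y) \<le> r x * r y" using D r by auto
          also have "\<dots> \<le> p x * q y"
            using r D(1)[OF \<open>r \<in> C\<close>] D(1)[OF \<open>p \<in> C\<close>] by (intro mult_mono) auto
          finally show "\<exists>r\<in>C. r (x * y) \<le> p x * q y" using r by blast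
        qed (use D in auto)
        show "u (x + y) \<le> max (u x) (u y)"
          unfolding u_def
        proof (intro INF_le_max False)
          fix p q assume "p \<in> C" "q \<in> C"
          then obtain r where r: "r \<in> C" "?P p r" "?P q r" using chain by blast
          have "r (x + y) \<le> max (r x) (r y)" using D r by auto
          also have "\<dots> \<le> max (p x) (q y)"
            using r by (intro max.mono) auto
          finally show "\<exists>r\<in>C. r (x + y) \<le> max (p x) (q y)" using r by blast
        qed (use D in auto)
        show "u (a * x) \<le> b * u x"
          unfolding u_def
          by (intro INF_le_cmult False) (use D b in auto)
        have "u x \<le> (1 / b) * u (a * x)"
          unfolding u_def
        proof (intro INF_le_cmult False)
          show "\<exists>q\<in>C. q x \<le> 1 / b * p (a * x)" if "p \<in> C" for p
            using that D(6)[OF that] b by (intro bexI[of _ p]) auto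
        qed (use D b in auto)
        then show "b * u x \<le> u (a * x)" using b by (simp add: field_simps)
      next
        show "1 \<le> u 1"
          unfolding u_def by (rule cINF_greatest[OF False]) (simp add: D(3))
      qed
      then show ?thesis using u_le by auto
    qed
  qed
  then show ?thesis using that by blast
qed

text \<open>The spectral seminorm \<open>q x = lim p (x ^ i) powr (1 / i)\<close> of \<open>p\<close> is again homogeneous and at
  most \<open>p\<close>. It is written as the infimum of all \<open>t\<close> with \<open>p (x ^ i) = O (t ^ i)\<close>, which avoids
  limits of roots.\<close>

lemma minimal_seminorm_power:
  fixes a :: "'a::comm_ring_1"
  assumes p: "p \<in> homogeneous_seminorms a b" and b: "0 < b"
    and min: "\<And>q. q \<in> homogeneous_seminorms a b \<Longrightarrow> (\<And>x. q x \<le> p x) \<Longrightarrow> q = p"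
  shows "p (x ^ m) = p x ^ m"
proof -
  note D = homogeneous_seminormsD[OF p] and P = homogeneous_seminorm_power[OF p]
  define T where "T x = {t::real. 0 < t \<and> (\<exists>C>0. \<forall>i. p (x ^ i) \<le> C * t ^ i)}" for x
  define q where "q x = (INF t\<in>T x. t)" for x
  have T_upper: "t \<in> T x" if "p x \<le> t" "0 < t" for t x
  proof -
    have "p (x ^ i) \<le> 1 * t ^ i" for i
      using P(1)[of x i] power_mono[OF that(1) D(1), of i] by simp
    then show ?thesis unfolding T_def using that by (auto intro: exI[of _ 1])
  qed
  have T1: "1 \<in> T x" for x using T_upper D by auto
  then have ne: "T x \<noteq> {}" for x by blast
  have pos: "0 \<le> t" if "t \<in> T x" for t x using that unfolding T_def by auto
  have q_le: "q x \<le> t" if "t \<in> T x" for t x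
    unfolding q_def using INF_bounds(2)[OF that, where f = "\<lambda>t. t"] pos by auto
  have q_le_p: "q x \<le> p x" for x
  proof (rule dense_ge)
    fix z assume "p x < z"
    then have "z \<in> T x" using T_upper[of x z] D(1)[of x] by auto
    then show "q x \<le> z" by (rule q_le)
  qed
  have q0: "0 \<le> q x" for x
    unfolding q_def using INF_bounds(1)[OF T1, where f = "\<lambda>t. t"] pos by auto
  have "q \<in> homogeneous_seminorms a b"
  proof (rule homogeneous_seminormsI)
    fix x y
    show "0 \<le> q x" by (rule q0)
    show "q x \<le> 1" using q_le T1 by auto
    show "q (x * y) \<le> q x * q y"
      unfolding q_def
    proof (intro INF_le_mult ne pos)
      fix t s assume t: "t \<in> T x" and s: "s \<in> T y"
      from t obtain C where C: "0 < C" "\<And>i. p (x ^ i) \<le> C * t ^ i" "0 < t"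
        unfolding T_def by auto
      from s obtain E where E: "0 < E" "\<And>i. p (y ^ i) \<le> E * s ^ i" "0 < s"
        unfolding T_def by auto
      have "p ((x * y) ^ i) \<le> (C * E) * (t * s) ^ i" for i
      proof -
        have "p ((x * y) ^ i) \<le> p (x ^ i) * p (y ^ i)"
          unfolding power_mult_distrib by (rule D)
        also have "\<dots> \<le> (C * t ^ i) * (E * s ^ i)"
          using C E D(1) by (intro mult_mono) auto
        finally show ?thesis by (simp add: power_mult_distrib mult_ac)
      qed
      moreover have "0 < t * s" "0 < C * E" using C E by auto
      ultimately have "t * s \<in> T (x * y)"
        unfolding T_def by blast
      then show "\<exists>u\<in>T (x * y). u \<le> t * s" by blast
    qed auto
    show "q (x + y) \<le> max (q x) (q y)"
      unfolding q_def
    proof (intro INF_le_max ne pos)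
      fix t s assume t: "t \<in> T x" and s: "s \<in> T y"
      from t obtain C where C: "0 < C" "\<And>i. p (x ^ i) \<le> C * t ^ i" "0 < t"
        unfolding T_def by auto
      from s obtain E where E: "0 < E" "\<And>i. p (y ^ i) \<le> E * s ^ i" "0 < s"
        unfolding T_def by auto
      let ?u = "max t s"
      \<comment> \<open>Since \<open>p\<close> is bounded by 1, multiplying by any ring element,
        such as a binomial coefficient, cannot increase a bound.\<close>
      have mono: "p (w * z) \<le> B" if "p z \<le> B" for w z B
        using D(4)[of w z] that mult_right_mono[OF D(2)[of w] D(1)[of z]] by simp
      \<comment> \<open>Each term of the binomial expansion is at most
        \<open>C * E * ?u ^ i\<close>, and by the ultrametric inequality so is their sum, with a
        constant that does not depend on \<open>i\<close>.\<close>
      have "p ((x + y) ^ i) \<le> (C * E) * ?u ^ i" for i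
      proof -
        have 1: "p (of_nat (i choose k) * x ^ k * y ^ (i - k)) \<le> (C * E) * ?u ^ i"
          if "k \<le> i" for k
        proof -
          have "p (x ^ k * y ^ (i - k)) \<le> p (x ^ k) * p (y ^ (i - k))" by (rule D)
          also have "\<dots> \<le> (C * t ^ k) * (E * s ^ (i - k))"
            using C E D(1) by (intro mult_mono) auto
          also have "\<dots> \<le> (C * ?u ^ k) * (E * ?u ^ (i - k))"
            using C E by (intro mult_mono mult_left_mono power_mono) auto
          also have "\<dots> = (C * E) * ?u ^ i"
            using that by (simp flip: power_add)
          finally show ?thesis unfolding mult.assoc by (rule mono)
        qed
        have sum: "p (sum f K) \<le> (C * E) * ?u ^ i"
          if "finite K" "\<And>k. k \<in> K \<Longrightarrow> p (f k) \<le> (C * E) * ?u ^ i" for f :: "nat \<Rightarrow> 'a" and K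
          using that
        proof (induction K)
          case empty
          \<comment> \<open>The empty sum is bounded as a multiple of the term \<open>y ^ i\<close>,
            without using a value for \<open>p 0\<close>.\<close>
          have "p 0 = p (0 * y ^ i)" by simp
          also have "\<dots> \<le> C * E * ?u ^ i" using 1[of 0] mono[of "1 * y ^ i" _ 0] by simp
          finally show ?case by simp
        next
          case (insert k K)
          then show ?case using D(5)[of "f k" "sum f K"] by fastforce
        qed
        show ?thesis unfolding binomial_ring by (rule sum) (use 1 in auto)
      qed
      moreover have "0 < ?u" "0 < C * E" using C E by auto
      ultimately have "?u \<in> T (x + y)"
        unfolding T_def by blast
      then show "\<exists>u\<in>T (x + y). u \<le> ?u" by blast
    qed
    show "q (a * x) \<le> b * q x"
      unfolding q_def
    proof (rule INF_le_cmult)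
      fix t assume "t \<in> T x"
      then obtain C where C: "0 < C" "\<And>i. p (x ^ i) \<le> C * t ^ i" "0 < t"
        unfolding T_def by auto
      have "p ((a * x) ^ i) \<le> C * (b * t) ^ i" for i
        unfolding power_mult_distrib P(2) using b mult_left_mono[OF C(2)[of i], of "b ^ i"]
        by (simp add: mult.left_commute)
      moreover have "0 < b * t" using b C by simp
      ultimately have "b * t \<in> T (a * x)"
        unfolding T_def using C(1) by blast
      then show "\<exists>u\<in>T (a * x). u \<le> b * t" by blast
    qed (use b ne pos in auto)
    have "q x \<le> (1 / b) * q (a * x)"
      unfolding q_def
    proof (rule INF_le_cmult)
      fix t assume "t \<in> T (a * x)"
      then obtain C where C: "0 < C" "\<And>i. p ((a * x) ^ i) \<le> C * t ^ i" "0 < t"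
        unfolding T_def by auto
      have "p (x ^ i) \<le> C * (1 / b * t) ^ i" for i
        using C(2)[of i] b by (simp add: power_mult_distrib P(2) power_divide field_simps)
      moreover have "0 < 1 / b * t" using b C by simp
      ultimately have "1 / b * t \<in> T x"
        unfolding T_def using C(1) by blast
      then show "\<exists>u\<in>T x. u \<le> 1 / b * t" by blast
    qed (use b ne pos in auto)
    then show "b * q x \<le> q (a * x)" using b by (simp add: field_simps)
  next
    show "1 \<le> q 1"
      unfolding q_def
    proof (rule cINF_greatest[OF ne])
      fix t assume "t \<in> T 1"
      then obtain C where C: "0 < C" "\<And>i. 1 \<le> C * t ^ i" "0 < t"
        unfolding T_def using D(3) by auto
      \<comment> \<open>For \<open>t < 1\<close> the bound \<open>C * t ^ i\<close> would tend to 0,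
        although it is at least \<open>p 1 = 1\<close>.\<close>
      show "1 \<le> t"
      proof (rule ccontr)
        assume "\<not> 1 \<le> t"
        then obtain i where "t ^ i < 1 / C"
          using real_arch_pow_inv[of "1 / C" t] C(1) by auto
        then show False using C(1) C(2)[of i] by (simp add: field_simps)
      qed
    qed
  qed
  then have qp: "q = p" using q_le_p by (rule min)
  \<comment> \<open>Now that \<open>q = p\<close>, it suffices that the \<open>m\<close>-th root
    \<open>t\<close> of any \<open>u > p (x ^ m)\<close> is an admissible growth rate for the powers
    of \<open>x\<close>. Exponents are divided by \<open>m\<close> with remainder.\<close>
  have "p x ^ m \<le> p (x ^ m)"
  proof (cases "m = 0")
    case True
    then show ?thesis using D by simp
  next
    case m: False
    show ?thesis
    proof (rule dense_ge)
      fix u assume u: "p (x ^ m) < u"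
      then have "0 < u" using D(1)[of "x ^ m"] by linarith
      define t where "t = root m u"
      have t: "0 < t" "t ^ m = u" using \<open>0 < u\<close> m unfolding t_def by auto
      \<comment> \<open>A bound for all factors \<open>1 / t ^ r\<close> with \<open>r < m\<close>
        at once; such a factor is the cost of the remainder \<open>r\<close>.\<close>
      define C where "C = (\<Sum>r<m. 1 / t ^ r)"
      have "0 < C" unfolding C_def using m t by (intro sum_pos) (auto simp: lessThan_empty_iff)
      have "p (x ^ i) \<le> C * t ^ i" for i
      proof -
        define d r where "d = i div m" and "r = i mod m"
        have i: "i = m * d + r" and r: "r < m" using m unfolding d_def r_def by auto
        have "p (x ^ i) \<le> p ((x ^ m) ^ d) * p (x ^ r)"
          unfolding i power_add power_mult by (rule D)
        also have "\<dots> \<le> p (x ^ m) ^ d * 1"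
          using D P by (intro mult_mono) auto
        also have "\<dots> \<le> u ^ d"
          using u D(1) by (auto intro: power_mono)
        also have "\<dots> = (1 / t ^ r) * t ^ i"
          using t by (simp add: i power_add power_mult)
        also have "\<dots> \<le> C * t ^ i"
          unfolding C_def using t r by (intro mult_right_mono member_le_sum) auto
        finally show ?thesis .
      qed
      then have "t \<in> T x" unfolding T_def using t \<open>0 < C\<close> by auto
      then have "p x \<le> t" using q_le qp by auto
      then show "p x ^ m \<le> u" using power_mono[OF _ D(1)[of x], of t m] t by simp
    qed
  qed
  then show ?thesis using P(1)[of x m] by simp
qed

text \<open>For \<open>p x > 0\<close> minimality is applied to \<open>q y = lim p (x ^ n * y) / p x ^ n\<close>; here \<open>q 1 = 1\<close>
  because \<open>p\<close> is power-multiplicative. The term \<open>n = 1\<close> then gives \<open>p y \<le> p (x * y) / p x\<close>.\<close>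

lemma minimal_seminorm_mult:
  fixes a :: "'a::comm_ring_1"
  assumes p: "p \<in> homogeneous_seminorms a b" and b: "0 < b"
    and min: "\<And>q. q \<in> homogeneous_seminorms a b \<Longrightarrow> (\<And>x. q x \<le> p x) \<Longrightarrow> q = p"
  shows "p (x * y) = p x * p y"
proof (cases "p x = 0")
  case True
  then show ?thesis
    using homogeneous_seminormsD(1)[OF p, of "x * y"] homogeneous_seminormsD(4)[OF p, of x y] by simp
next
  case False
  note D = homogeneous_seminormsD[OF p]
  have px: "0 < p x" using False D(1)[of x] by simp
  define f where "f y n = p (x ^ n * y) / p x ^ n" for y n
  define q where "q y = (INF n. f y n)" for y
  have f0: "0 \<le> f y n" for y n unfolding f_def using D by simp
  have q_le: "q y \<le> f y n" and q0: "0 \<le> q y" for y n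
    unfolding q_def using INF_bounds[of n UNIV "f y"] f0 by auto
  have q_le_p: "q y \<le> p y" for y using q_le[of y 0] by (simp add: f_def)
  have "q \<in> homogeneous_seminorms a b"
  proof (rule homogeneous_seminormsI)
    fix y z
    show "0 \<le> q y" by (rule q0)
    show "q y \<le> 1" using q_le_p[of y] D(2)[of y] by simp
    show "q (y * z) \<le> q y * q z"
      unfolding q_def
    proof (rule INF_le_mult)
      fix n m
      have "p (x ^ (n + m) * (y * z)) \<le> p (x ^ n * y) * p (x ^ m * z)"
        using D(4)[of "x ^ n * y" "x ^ m * z"] by (simp add: power_add mult_ac)
      then have "f (y * z) (n + m) \<le> f y n * f z m"
        unfolding f_def using px by (simp add: power_add divide_right_mono)
      then show "\<exists>k\<in>UNIV. f (y * z) k \<le> f y n * f z m" by blast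
    qed (use f0 in auto)
    show "q (y + z) \<le> max (q y) (q z)"
      unfolding q_def
    proof (rule INF_le_max)
      fix n m
      \<comment> \<open>The sequence \<open>f w\<close> is decreasing, so the indices
        \<open>n\<close> and \<open>m\<close> can both be raised to \<open>n + m\<close>, where the
        ultrametric inequality for \<open>p\<close> applies.\<close>
      have step: "f w (i + j) \<le> f w i" for w i j
      proof -
        have "p (x ^ (i + j) * w) \<le> p (x ^ j) * p (x ^ i * w)"
          using D(4)[of "x ^ j" "x ^ i * w"] by (simp add: power_add mult_ac)
        also have "\<dots> \<le> p x ^ j * p (x ^ i * w)"
          using homogeneous_seminorm_power[OF p] D(1) by (intro mult_right_mono)
        finally show ?thesis unfolding f_def using px by (simp add: power_add field_simps)
      qed
      have "p (x ^ k * (y + z)) \<le> max (p (x ^ k * y)) (p (x ^ k * z))" for k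
        unfolding distrib_left by (rule D)
      from divide_right_mono[OF this, of "p x ^ k" for k]
      have "f (y + z) k \<le> max (f y k) (f z k)" for k
        using px unfolding f_def by (simp add: max_divide_distrib_right)
      from this[of "n + m"] have "f (y + z) (n + m) \<le> max (f y n) (f z m)"
        using step[of y n m] step[of z m n] by (simp add: add.commute max_def split: if_splits)
      then show "\<exists>k\<in>UNIV. f (y + z) k \<le> max (f y n) (f z m)" by blast
    qed (use f0 in auto)
    have fa: "f (a * y) n = b * f y n" for n
      unfolding f_def using D(6)[of "x ^ n * y"] by (simp add: mult.left_commute)
    show "q (a * y) \<le> b * q y"
      unfolding q_def by (rule INF_le_cmult) (use f0 fa b in auto)
    have "q y \<le> (1 / b) * q (a * y)"
      unfolding q_def by (rule INF_le_cmult) (use f0 fa b in auto)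
    then show "b * q y \<le> q (a * y)" using b by (simp add: field_simps)
  next
    have "p (x ^ n) = p x ^ n" for n by (rule minimal_seminorm_power[OF p b min])
    then show "1 \<le> q 1" using px unfolding q_def f_def by simp
  qed
  then have "q = p" using q_le_p by (rule min)
  then have "p y \<le> p (x * y) / p x" using q_le[of y 1] by (simp add: f_def)
  then have "p x * p y \<le> p (x * y)" using px by (simp add: field_simps)
  then show ?thesis using D(4)[of x y] by simp
qed

text \<open>Equivalently, \<open>- ln (N x)\<close> is a nonnegative real valuation, possibly
  trivial, on the quotient by the prime ideal of all \<open>x\<close> with
  \<open>N x = 0\<close>.\<close>

locale multiplicative_seminorm =
  fixes N :: "'a::comm_ring_1 \<Rightarrow> real"
  assumes nonneg: "0 \<le> N x" and le_one: "N x \<le> 1"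
    and zero [simp]: "N 0 = 0" and one [simp]: "N 1 = 1"
    and mult: "N (x * y) = N x * N y"
    and add: "N (x + y) \<le> max (N x) (N y)"

theorem exists_multiplicative_seminorm:
  fixes a :: "'a::comm_ring_1"
  assumes "\<And>n. \<not> a ^ (n + 1) dvd a ^ n" and b: "0 < b" "b < 1"
  obtains N where "multiplicative_seminorm N" "N a = b"
proof -
  obtain p where p: "p \<in> homogeneous_seminorms a b"
    and min: "\<And>q. q \<in> homogeneous_seminorms a b \<Longrightarrow> (\<And>x. q x \<le> p x) \<Longrightarrow> q = p"
    using minimal_seminorm[OF adic_seminorm[OF assms] b(1)] by blast
  note D = homogeneous_seminormsD[OF p]
  have "p 0 = 0" using D(6)[of 0] b by auto
  moreover have "p (x * y) = p x * p y" for x y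
    by (rule minimal_seminorm_mult[OF p b(1) min])
  ultimately have "multiplicative_seminorm p"
    by unfold_locales (use D in auto)
  moreover have "p a = b" using D(6)[of 1] D(3) by simp
  ultimately show ?thesis by (rule that)
qed

section \<open>Minors\<close>

text \<open>The easy direction of the Frobenius-Koenig theorem: by counting, every permutation maps
  some element of \<open>S\<close> into \<open>T\<close>, so every term of the Leibniz formula
  contains a zero factor.\<close>

lemma det_zero_block:
  assumes M: "M \<in> carrier_mat k k" and S: "S \<subseteq> {0..<k}" and T: "T \<subseteq> {0..<k}"
    and card: "k < card S + card T" and zero: "\<And>i j. i \<in> S \<Longrightarrow> j \<in> T \<Longrightarrow> M $$ (i, j) = 0"
  shows "det M = 0"
  unfolding det_def'[OF M]
proof (rule sum.neutral, safe)
  fix p assume p: "p permutes {0..<k}"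
  have "p ` S \<inter> T \<noteq> {}"
  proof
    assume disj: "p ` S \<inter> T = {}"
    have pS: "p ` S \<subseteq> {0..<k}"
      using S permutes_image[OF p] by blast
    have "card (p ` S) = card S"
      by (rule card_image) (rule permutes_inj_on[OF p])
    moreover have "finite (p ` S)" "finite T"
      using pS T finite_subset by blast+
    then have "card (p ` S \<union> T) = card (p ` S) + card T"
      using disj by (rule card_Un_disjoint)
    moreover have "card (p ` S \<union> T) \<le> card {0..<k}"
      using pS T by (intro card_mono) auto
    ultimately show False using card by simp
  qed
  then obtain i where "i \<in> S" "p i \<in> T" by auto
  then have "(\<Prod>i = 0..<k. M $$ (i, p i)) = 0"
    using zero S by (intro prod_zero) auto
  then show "signof p * (\<Prod>i = 0..<k. M $$ (i, p i)) = 0" by simp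
qed

lemma det_permute_cols:
  assumes M: "M \<in> carrier_mat k k" and p: "p permutes {0..<k}"
  shows "det (mat k k (\<lambda>(i, j). M $$ (i, p j))) = signof p * det M"
proof -
  have "mat k k (\<lambda>(i, j). M $$ (i, p j))
      = transpose_mat (mat k k (\<lambda>(i, j). transpose_mat M $$ (p i, j)))"
    using M permutes_in_image[OF p] by (intro eq_matI) auto
  then have "det (mat k k (\<lambda>(i, j). M $$ (i, p j)))
      = det (mat k k (\<lambda>(i, j). transpose_mat M $$ (p i, j)))"
    using det_transpose[of "mat k k (\<lambda>(i, j). transpose_mat M $$ (p i, j))" k] by simp
  also have "\<dots> = signof p * det (transpose_mat M)"
    using M p by (intro det_permute_rows) auto
  finally show ?thesis using det_transpose[OF M] by simp
qed

text \<open>The library has this only over integral domains.\<close>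

lemma det_four_block_mat_upper_triangular:
  fixes A :: "'a::comm_ring_1 mat"
  assumes A: "A \<in> carrier_mat m m" and C: "C \<in> carrier_mat m n" and B: "B \<in> carrier_mat n n"
  shows "det (four_block_mat A C (0\<^sub>m n m) B) = det A * det B"
proof -
  \<comment> \<open>\<open>left\<close> and \<open>right\<close> compute the determinants of the two
    factors in the factorization at the end. Both are inductions that split off a one-by-one
    identity block.\<close>
  have left: "det (four_block_mat (1\<^sub>m m) C (0\<^sub>m n m) B) = det B" if "C \<in> carrier_mat m n" for C m
    using that
  proof (induction m arbitrary: C)
    case 0
    then have "four_block_mat (1\<^sub>m 0) C (0\<^sub>m n 0) B = B"
      using B by (intro eq_matI) auto
    then show ?case by simp
  next
    case (Suc m)
    let ?C = "mat m n (\<lambda>(i, j). C $$ (Suc i, j))"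
    let ?M = "four_block_mat (1\<^sub>m m) ?C (0\<^sub>m n m) B"
    let ?R = "mat 1 (m + n) (\<lambda>(i, j). if j < m then 0 else C $$ (0, j - m))"
    have "four_block_mat (1\<^sub>m (Suc m)) C (0\<^sub>m n (Suc m)) B
        = four_block_mat (1\<^sub>m 1) ?R (0\<^sub>m (m + n) 1) ?M"
      using Suc.prems B by (intro eq_matI) (auto simp: less_Suc_eq_0_disj not_less)
    also have "det \<dots> = det (1\<^sub>m 1 :: 'a mat) * det ?M"
      using B by (intro det_four_block_mat_lower_left_zero_col) auto
    finally show ?case using Suc.IH[of ?C] by simp
  qed
  have right: "det (four_block_mat A (0\<^sub>m m l) (0\<^sub>m l m) (1\<^sub>m l)) = det A" for l
  proof (induction l)
    case 0
    have "four_block_mat A (0\<^sub>m m 0) (0\<^sub>m 0 m) (1\<^sub>m 0) = A"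
      using A by (intro eq_matI) auto
    then show ?case by simp
  next
    case (Suc l)
    let ?M = "four_block_mat A (0\<^sub>m m l) (0\<^sub>m l m) (1\<^sub>m l)"
    have "four_block_mat A (0\<^sub>m m (Suc l)) (0\<^sub>m (Suc l) m) (1\<^sub>m (Suc l))
        = four_block_mat ?M (0\<^sub>m (m + l) 1) (0\<^sub>m 1 (m + l)) (1\<^sub>m 1)"
      using A by (intro eq_matI) (auto simp: less_Suc_eq less_diff_conv2 not_less)
    also have "det \<dots> = det ?M * det (1\<^sub>m 1 :: 'a mat)"
      using A by (intro det_four_block_mat_upper_right_zero_col) auto
    finally show ?case using Suc.IH by simp
  qed
  have "four_block_mat A C (0\<^sub>m n m) B
      = four_block_mat (1\<^sub>m m) C (0\<^sub>m n m) B * four_block_mat A (0\<^sub>m m n) (0\<^sub>m n m) (1\<^sub>m n)"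
    by (subst mult_four_block_mat[of _ m m _ n _ n _ _ m _ n]) (use A B C in auto)
  also have "det \<dots> = det B * det A"
    using A B C left[OF C] right[of n] by (subst det_mult[of _ "m + n"]) auto
  finally show ?thesis by (simp add: mult.commute)
qed

text \<open>The Cauchy-Binet formula before terms are grouped, obtained by multilinear expansion in
  the rows of \<open>X * Y\<close>. Requiring \<open>f i = i\<close> outside the range makes the
  index set finite.\<close>

lemma det_mult_rectangular:
  fixes X :: "'a::comm_ring_1 mat"
  assumes X: "X \<in> carrier_mat k n" and Y: "Y \<in> carrier_mat n k"
  shows "det (X * Y) =
    (\<Sum>f\<in>{f. (\<forall>i\<in>{0..<k}. f i \<in> {0..<n}) \<and> (\<forall>i. i \<notin> {0..<k} \<longrightarrow> f i = i)}.
       (\<Prod>i = 0..<k. X $$ (i, f i)) * det (mat k k (\<lambda>(i, j). Y $$ (f i, j))))"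
proof -
  have "det (mat\<^sub>r k k (\<lambda>i. X $$ (i, f i) \<cdot>\<^sub>v row Y (f i)))
      = (\<Prod>i = 0..<k. X $$ (i, f i)) * det (mat k k (\<lambda>(i, j). Y $$ (f i, j)))"
    if "\<forall>i\<in>{0..<k}. f i \<in> {0..<n}" for f
  proof -
    have "mat\<^sub>r k k (\<lambda>i. row Y (f i)) = mat k k (\<lambda>(i, j). Y $$ (f i, j))"
      using that Y by (intro eq_matI) auto
    then show ?thesis
      using Y by (subst det_rows_mul) auto
  qed
  then show ?thesis
    unfolding mat_mul_finsum_alt[OF X Y]
    by (subst det_linear_rows_sum) (use Y in \<open>auto intro!: sum.cong\<close>)
qed

section \<open>Minors of products and of block matrices\<close>

text \<open>The index functions need not be injective or monotone; this adds only zeros and signs.\<close>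

definition minors :: "'a::comm_ring_1 mat \<Rightarrow> nat \<Rightarrow> 'a set" where
  "minors A k = {det (mat k k (\<lambda>(i, j). A $$ (f i, g j))) | f g.
     (\<forall>i<k. f i < dim_row A) \<and> (\<forall>j<k. g j < dim_col A)}"

lemma minorsI:
  assumes "\<And>i. i < k \<Longrightarrow> f i < dim_row A" "\<And>j. j < k \<Longrightarrow> g j < dim_col A"
    "\<And>i j. i < k \<Longrightarrow> j < k \<Longrightarrow> M $$ (i, j) = A $$ (f i, g j)" "M \<in> carrier_mat k k"
  shows "det M \<in> minors A k"
proof -
  have "M = mat k k (\<lambda>(i, j). A $$ (f i, g j))"
    using assms(3,4) by (intro eq_matI) auto
  then show ?thesis unfolding minors_def using assms(1,2) by blast
qed

lemma minorsE:
  assumes "d \<in> minors A k"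
  obtains f g M where "d = det M" "M \<in> carrier_mat k k"
    "\<And>i j. i < k \<Longrightarrow> j < k \<Longrightarrow> M $$ (i, j) = A $$ (f i, g j)"
    "\<And>i. i < k \<Longrightarrow> f i < dim_row A" "\<And>j. j < k \<Longrightarrow> g j < dim_col A"
proof -
  from assms obtain f g where "d = det (mat k k (\<lambda>(i, j). A $$ (f i, g j)))"
    "\<forall>i<k. f i < dim_row A" "\<forall>j<k. g j < dim_col A"
    unfolding minors_def by blast
  then show ?thesis by (intro that[of _ f g]) auto
qed

lemma minors_0: "minors A 0 = {1}"
  unfolding minors_def by auto

lemma minors_elem_mat: "minors (elem_mat x) 1 = {x}"
proof (intro equalityI subsetI)
  fix d assume "d \<in> minors (elem_mat x) 1"
  then show "d \<in> {x}" by (elim minorsE) (auto simp: det_single elem_mat_def)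
next
  fix d assume "d \<in> {x}"
  then have "d = det (elem_mat x)" by (simp add: det_single elem_mat_def)
  also have "\<dots> \<in> minors (elem_mat x) 1"
    by (rule minorsI[of _ id _ id]) (auto simp: elem_mat_def)
  finally show "d \<in> minors (elem_mat x) 1" .
qed

lemma minors_zero_mat:
  assumes "d \<in> minors (0\<^sub>m m n) k" "0 < k"
  shows "d = 0"
  using assms(1)
proof (rule minorsE)
  fix f g M assume M: "d = det M" "M \<in> carrier_mat k k"
    "\<And>i j. i < k \<Longrightarrow> j < k \<Longrightarrow> M $$ (i, j) = 0\<^sub>m m n $$ (f i, g j)"
    "\<And>i. i < k \<Longrightarrow> f i < dim_row (0\<^sub>m m n)" "\<And>j. j < k \<Longrightarrow> g j < dim_col (0\<^sub>m m n)"
  then show "d = 0"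
    using det_zero_block[of M k "{0..<k}" "{0..<k}"] assms(2) by auto
qed

lemma minors_transpose_subset: "minors A k \<subseteq> minors (transpose_mat A) k"
proof
  fix d assume "d \<in> minors A k"
  then obtain f g M where M: "d = det M" "M \<in> carrier_mat k k"
    "\<And>i j. i < k \<Longrightarrow> j < k \<Longrightarrow> M $$ (i, j) = A $$ (f i, g j)"
    "\<And>i. i < k \<Longrightarrow> f i < dim_row A" "\<And>j. j < k \<Longrightarrow> g j < dim_col A"
    by (rule minorsE) blast
  have "det (transpose_mat M) \<in> minors (transpose_mat A) k"
    by (rule minorsI[of _ g _ f]) (use M in auto)
  then show "d \<in> minors (transpose_mat A) k"
    using M(1) det_transpose[OF M(2)] by simp
qed

lemma minors_transpose: "minors (transpose_mat A) k = minors A k"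
  using minors_transpose_subset[of A k] minors_transpose_subset[of "transpose_mat A" k] by auto

lemma minors_large:
  assumes "d \<in> minors A k" "dim_row A < k"
  shows "d = 0"
  using assms(1)
proof (rule minorsE)
  fix f g M assume M: "d = det M" "M \<in> carrier_mat k k"
    "\<And>i j. i < k \<Longrightarrow> j < k \<Longrightarrow> M $$ (i, j) = A $$ (f i, g j)"
    "\<And>i. i < k \<Longrightarrow> f i < dim_row A" "\<And>j. j < k \<Longrightarrow> g j < dim_col A"
  have "\<not> inj_on f {0..<k}"
  proof
    assume "inj_on f {0..<k}"
    then have "card {0..<k} \<le> card {0..<dim_row A}"
      using M(4) by (intro card_inj_on_le[of f]) auto
    then show False using assms(2) by simp
  qed
  then obtain i j where ij: "i < k" "j < k" "f i = f j" "i \<noteq> j"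
    unfolding inj_on_def by auto
  then have "row M i = row M j"
    using M by (intro eq_vecI) auto
  then show "d = 0"
    using det_identical_rows[OF M(2) ij(4,1,2)] M(1) by simp
qed

text \<open>Selecting the rows and columns of both minors together gives a block upper triangular
  submatrix, with determinant \<open>d * e\<close> whatever \<open>C\<close> is.\<close>

lemma minors_mult_four_block_mat:
  assumes d: "d \<in> minors A k" and e: "e \<in> minors B l"
    and C: "C \<in> carrier_mat (dim_row A) (dim_col B)"
  shows "d * e \<in> minors (four_block_mat A C (0\<^sub>m (dim_row B) (dim_col A)) B) (k + l)"
proof -
  obtain f g M where M: "d = det M" "M \<in> carrier_mat k k"
    "\<And>i j. i < k \<Longrightarrow> j < k \<Longrightarrow> M $$ (i, j) = A $$ (f i, g j)"
    "\<And>i. i < k \<Longrightarrow> f i < dim_row A" "\<And>j. j < k \<Longrightarrow> g j < dim_col A"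
    using d by (rule minorsE) blast
  obtain f' g' M' where M': "e = det M'" "M' \<in> carrier_mat l l"
    "\<And>i j. i < l \<Longrightarrow> j < l \<Longrightarrow> M' $$ (i, j) = B $$ (f' i, g' j)"
    "\<And>i. i < l \<Longrightarrow> f' i < dim_row B" "\<And>j. j < l \<Longrightarrow> g' j < dim_col B"
    using e by (rule minorsE) blast
  let ?C = "mat k l (\<lambda>(i, j). C $$ (f i, g' j))"
  have "d * e = det (four_block_mat M ?C (0\<^sub>m l k) M')"
    using det_four_block_mat_upper_triangular[OF M(2) _ M'(2), of ?C] M(1) M'(1) by simp
  also have "\<dots> \<in> minors (four_block_mat A C (0\<^sub>m (dim_row B) (dim_col A)) B) (k + l)"
    by (rule minorsI[where f = "\<lambda>i. if i < k then f i else dim_row A + f' (i - k)"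
          and g = "\<lambda>j. if j < k then g j else dim_col A + g' (j - k)"])
      (use M M' C in \<open>auto simp: trans_less_add1\<close>)
  finally show ?thesis .
qed

text \<open>Serves to sort the rows and columns of a minor by the block they come from, since the
  index functions of a minor need not be monotone.\<close>

lemma permutes_sort_predicate:
  fixes k :: nat
  obtains p l where "p permutes {0..<k}" "l \<le> k" "\<And>i. i < k \<Longrightarrow> P (p i) \<longleftrightarrow> i < l"
proof -
  define S l where "S = {i \<in> {0..<k}. P i}" and "l = card S"
  have S: "S \<subseteq> {0..<k}" "finite S" unfolding S_def by auto
  then have l: "l \<le> k" unfolding l_def using card_mono[of "{0..<k}" S] by simp
  obtain h where h: "bij_betw h {0..<l} S"
    unfolding l_def using ex_bij_betw_nat_finite[OF S(2)] by blast
  have "card {l..<k} = card ({0..<k} - S)"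
    using S by (simp add: card_Diff_subset l_def)
  then obtain h' where h': "bij_betw h' {l..<k} ({0..<k} - S)"
    using finite_same_card_bij[of "{l..<k}" "{0..<k} - S"] by auto
  define p where "p i = (if i < l then h i else if i < k then h' i else i)" for i
  have p1: "bij_betw p {0..<l} S"
    using h by (subst bij_betw_cong[of _ _ h]) (auto simp: p_def)
  have p2: "bij_betw p {l..<k} ({0..<k} - S)"
    using h' by (subst bij_betw_cong[of _ _ h']) (auto simp: p_def)
  have "bij_betw p ({0..<l} \<union> {l..<k}) (S \<union> ({0..<k} - S))"
    using p1 p2 by (rule bij_betw_combine) auto
  moreover have "{0..<l} \<union> {l..<k} = {0..<k}" "S \<union> ({0..<k} - S) = {0..<k}"
    using l S by auto
  ultimately have "bij_betw p {0..<k} {0..<k}" by simp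
  then have "p permutes {0..<k}"
    by (rule bij_imp_permutes) (use l in \<open>auto simp: p_def\<close>)
  moreover have "P (p i) \<longleftrightarrow> i < l" if "i < k" for i
  proof (cases "i < l")
    case True
    then have "p i \<in> S" using bij_betwE[OF p1] by auto
    then show ?thesis using True unfolding S_def by simp
  next
    case False
    then have "p i \<in> {0..<k} - S" using bij_betwE[OF p2] that by auto
    then show ?thesis using False unfolding S_def by simp
  qed
  ultimately show ?thesis using l that by blast
qed

text \<open>Sorting rows and columns by block costs a sign \<open>s\<close> and leaves two diagonal
  blocks. If these are not square the minor vanishes; otherwise it is the product of a minor of
  \<open>A\<close> and a minor of \<open>B\<close>.\<close>

lemma minors_block_diagonal:
  fixes A B :: "'a::comm_ring_1 mat"
  assumes "d \<in> minors (four_block_mat A (0\<^sub>m (dim_row A) (dim_col B)) (0\<^sub>m (dim_row B) (dim_col A)) B) k"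
    and "d \<noteq> 0"
  obtains l m d1 d2 s where "k = l + m" "d1 \<in> minors A l" "d2 \<in> minors B m"
    "s = 1 \<or> s = -1" "s * d = d1 * d2"
proof -
  let ?D = "four_block_mat A (0\<^sub>m (dim_row A) (dim_col B)) (0\<^sub>m (dim_row B) (dim_col A)) B"
  obtain f g M where M: "d = det M" "M \<in> carrier_mat k k"
    "\<And>i j. i < k \<Longrightarrow> j < k \<Longrightarrow> M $$ (i, j) = ?D $$ (f i, g j)"
    "\<And>i. i < k \<Longrightarrow> f i < dim_row ?D" "\<And>j. j < k \<Longrightarrow> g j < dim_col ?D"
    using assms(1) by (rule minorsE) blast
  obtain p l where p: "p permutes {0..<k}" "l \<le> k" "\<And>i. i < k \<Longrightarrow> f (p i) < dim_row A \<longleftrightarrow> i < l"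
    using permutes_sort_predicate[of k "\<lambda>i. f i < dim_row A"] by blast
  obtain q m where q: "q permutes {0..<k}" "m \<le> k" "\<And>i. i < k \<Longrightarrow> g (q i) < dim_col A \<longleftrightarrow> i < m"
    using permutes_sort_predicate[of k "\<lambda>i. g i < dim_col A"] by blast
  have pk: "p i < k" if "i < k" for i using permutes_in_image[OF p(1)] that by auto
  have qk: "q i < k" if "i < k" for i using permutes_in_image[OF q(1)] that by auto
  define L where "L = mat k k (\<lambda>(i, j). M $$ (p i, q j))"
  have L: "L \<in> carrier_mat k k" unfolding L_def by simp
  have "L = mat k k (\<lambda>(i, j). mat k k (\<lambda>(i, j). M $$ (p i, j)) $$ (i, q j))"
    unfolding L_def using qk by (intro eq_matI) auto
  then have det_L: "det L = signof q * (signof p * d)"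
    using det_permute_cols[OF _ q(1), of "mat k k (\<lambda>(i, j). M $$ (p i, j))"]
      det_permute_rows[OF M(2) p(1)] M(1) by simp
  define s where "s = signof q * (signof p :: 'a)"
  have s: "s = 1 \<or> s = -1" unfolding s_def by (auto simp: sign_def)
  have det_L: "det L = s * d" unfolding det_L s_def by (simp add: mult.assoc)
  have L_entry: "L $$ (i, j) = ?D $$ (f (p i), g (q j))" if "i < k" "j < k" for i j
    unfolding L_def using that pk qk M(3) by simp
  have bounds: "f (p i) < dim_row A + dim_row B" "g (q i) < dim_col A + dim_col B" if "i < k" for i
    using that pk qk M(4,5) by auto
  have upper: "L $$ (i, j) = 0" if "i < l" "j \<in> {m..<k}" for i j
  proof -
    have "f (p i) < dim_row A" "\<not> g (q j) < dim_col A" "i < k" "j < k"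
      using that p(2,3) q(3) by auto
    moreover from this have "g (q j) - dim_col A < dim_col B"
      using bounds(2)[of j] by simp
    ultimately show ?thesis using L_entry bounds by simp
  qed
  have lower: "L $$ (i, j) = 0" if "i \<in> {l..<k}" "j < m" for i j
  proof -
    have "\<not> f (p i) < dim_row A" "g (q j) < dim_col A" "i < k" "j < k"
      using that p(3) q(2,3) by auto
    moreover from this have "f (p i) - dim_row A < dim_row B"
      using bounds(1)[of i] by simp
    ultimately show ?thesis using L_entry bounds by simp
  qed
  have "det L \<noteq> 0" using det_L s assms(2) by auto
  \<comment> \<open>If \<open>A\<close> contributes \<open>l\<close> rows but \<open>m\<close>
    columns with \<open>l\<close> different from \<open>m\<close>, one of the off-diagonal zero
    blocks has more than \<open>k\<close> rows and columns in total.\<close>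
  have "l = m"
  proof (rule ccontr)
    assume "l \<noteq> m"
    then consider "m < l" | "l < m" by linarith
    then have "det L = 0"
    proof cases
      case 1
      then show ?thesis
        using p(2) q(2) upper by (intro det_zero_block[OF L, of "{0..<l}" "{m..<k}"]) auto
    next
      case 2
      then show ?thesis
        using p(2) q(2) lower by (intro det_zero_block[OF L, of "{l..<k}" "{0..<m}"]) auto
    qed
    then show False using \<open>det L \<noteq> 0\<close> by simp
  qed
  let ?A = "mat l l (\<lambda>(i, j). L $$ (i, j))"
  let ?B = "mat (k - l) (k - l) (\<lambda>(i, j). L $$ (l + i, l + j))"
  have "L = four_block_mat ?A (0\<^sub>m l (k - l)) (0\<^sub>m (k - l) l) ?B"
    using L p(2) upper lower \<open>l = m\<close> by (intro eq_matI) auto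
  then have "det L = det ?A * det ?B"
    using det_four_block_mat_upper_triangular[of ?A l "0\<^sub>m l (k - l)" "k - l" ?B] by simp
  moreover have "det ?A \<in> minors A l"
  proof (rule minorsI[where f = "\<lambda>i. f (p i)" and g = "\<lambda>j. g (q j)"])
    show f: "f (p i) < dim_row A" if "i < l" for i using p(2) p(3)[of i] that by simp
    show g: "g (q j) < dim_col A" if "j < l" for j using q(2) q(3)[of j] that \<open>l = m\<close> by simp
    show "?A $$ (i, j) = A $$ (f (p i), g (q j))" if "i < l" "j < l" for i j
      using f[of i] g[of j] that L_entry[of i j] p(2) by simp
  qed simp
  moreover have "det ?B \<in> minors B (k - l)"
  proof (rule minorsI[where f = "\<lambda>i. f (p (l + i)) - dim_row A" and g = "\<lambda>j. g (q (l + j)) - dim_col A"])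
    fix i j assume ij: "i < k - l" "j < k - l"
    have k: "l + i < k" "l + j < k" using ij by linarith+
    have f: "\<not> f (p (l + i)) < dim_row A" using p(3)[OF k(1)] by simp
    have g: "\<not> g (q (l + j)) < dim_col A" using q(3)[OF k(2)] \<open>l = m\<close> by simp
    show "?B $$ (i, j) = B $$ (f (p (l + i)) - dim_row A, g (q (l + j)) - dim_col A)"
      using f g ij L_entry[OF k] bounds(1)[OF k(1)] bounds(2)[OF k(2)] by simp
  next
    fix i assume "i < k - l"
    then have "l + i < k" by linarith
    then show "f (p (l + i)) - dim_row A < dim_row B" "g (q (l + i)) - dim_col A < dim_col B"
      using p(3)[of "l + i"] q(3)[of "l + i"] bounds[of "l + i"] \<open>l = m\<close> by auto
  qed simp
  ultimately show ?thesis
    using that[of l "k - l" "det ?A" "det ?B" s] p(2) det_L s by simp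
qed

section \<open>The rank function of a multiplicative seminorm\<close>

context multiplicative_seminorm
begin

lemma N_minus [simp]: "N (- x) = N x"
proof -
  have "N (- y) \<le> N y" for y
    using mult[of "-1" y] le_one[of "-1"] nonneg[of y] mult_right_mono[of "N (-1)" 1 "N y"] by simp
  from this[of x] this[of "- x"] show ?thesis by simp
qed

lemma N_mult_le: "N (x * y) \<le> N y"
  unfolding mult using le_one nonneg by (simp add: mult_left_le_one_le)

text \<open>By the ultrametric inequality some term is at least as large as the sum; positivity
  excludes the empty sum, which offers no term to choose.\<close>

lemma N_sum_le:
  assumes "finite S" "0 < N (sum f S)"
  obtains i where "i \<in> S" "N (sum f S) \<le> N (f i)"
proof -
  have "sum f S = 0 \<or> (\<exists>i\<in>S. N (sum f S) \<le> N (f i))"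
    using assms(1)
  proof (induction S)
    case (insert i S)
    have "N (sum f (insert i S)) \<le> max (N (f i)) (N (sum f S))"
      using add insert.hyps by simp
    then consider "N (sum f (insert i S)) \<le> N (f i)" | "N (sum f (insert i S)) \<le> N (sum f S)"
      by (auto simp: le_max_iff_disj)
    then show ?case
    proof cases
      case 2
      show ?thesis
      proof (cases "sum f S = 0")
        case True
        then show ?thesis using insert.hyps by simp
      next
        case False
        then show ?thesis using insert.IH 2 by (meson insertI2 order_trans)
      qed
    qed blast
  qed simp
  then show ?thesis using assms(2) that by auto
qed

text \<open>By Cauchy-Binet, \<open>d\<close> is a linear combination of \<open>k\<close>-minors of
  \<open>B\<close>. The coefficients satisfy \<open>N \<le> 1\<close>, so one of these minors
  dominates \<open>d\<close>.\<close>

lemma minors_mult_le: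
  assumes d: "d \<in> minors (A * B) k" and pos: "0 < N d" and dim: "dim_col A = dim_row B"
  obtains e where "e \<in> minors B k" "N d \<le> N e"
proof -
  obtain f g M where M: "d = det M" "M \<in> carrier_mat k k"
    "\<And>i j. i < k \<Longrightarrow> j < k \<Longrightarrow> M $$ (i, j) = (A * B) $$ (f i, g j)"
    "\<And>i. i < k \<Longrightarrow> f i < dim_row (A * B)" "\<And>j. j < k \<Longrightarrow> g j < dim_col (A * B)"
    using d by (rule minorsE) blast
  let ?n = "dim_row B"
  let ?X = "mat k ?n (\<lambda>(i, j). A $$ (f i, j))" and ?Y = "mat ?n k (\<lambda>(i, j). B $$ (i, g j))"
  let ?F = "{h. (\<forall>i\<in>{0..<k}. h i \<in> {0..<?n}) \<and> (\<forall>i. i \<notin> {0..<k} \<longrightarrow> h i = i)}"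
  let ?t = "\<lambda>h. (\<Prod>i = 0..<k. ?X $$ (i, h i)) * det (mat k k (\<lambda>(i, j). ?Y $$ (h i, j)))"
  have "M = ?X * ?Y"
    using M(2-5) dim by (intro eq_matI) (auto simp: scalar_prod_def)
  then have d: "d = sum ?t ?F"
    unfolding M(1) by (simp only: det_mult_rectangular[of ?X k ?n ?Y] mat_carrier)
  have "finite ?F" by (rule finite_bounded_functions) auto
  then obtain h where h: "h \<in> ?F" "N d \<le> N (?t h)"
    using N_sum_le[of ?F ?t] pos unfolding d by blast
  have "det (mat k k (\<lambda>(i, j). ?Y $$ (h i, j))) \<in> minors B k"
    by (rule minorsI[of _ h _ g]) (use h(1) M(5) in auto)
  moreover have "N d \<le> N (det (mat k k (\<lambda>(i, j). ?Y $$ (h i, j))))"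
    using h(2) N_mult_le by (rule order_trans)
  ultimately show ?thesis by (rule that)
qed

text \<open>Over a valuation ring the supremum equals the sum of \<open>max 0 (1 + ln (N c))\<close> over the
  diagonal entries \<open>c\<close> with \<open>N c > 0\<close> of the Smith normal form of \<open>A\<close>.\<close>

definition minor_rank :: "'a mat \<Rightarrow> real" where
  "minor_rank A = Sup {real k + ln (N d) | k d. d \<in> minors A k \<and> 0 < N d}"

lemma minor_rank_ge:
  assumes "d \<in> minors A k" "0 < N d"
  shows "real k + ln (N d) \<le> minor_rank A"
  unfolding minor_rank_def
proof (rule cSup_upper)
  \<comment> \<open>Minors larger than the number of rows vanish, and \<open>ln (N d)\<close> is
    never positive.\<close>
  show "bdd_above {real k + ln (N d) | k d. d \<in> minors A k \<and> 0 < N d}"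
  proof (rule bdd_aboveI[of _ "real (dim_row A)"], safe)
    fix k d assume d: "d \<in> minors A k" "0 < N d"
    then have "k \<le> dim_row A" using minors_large[of d A k] by fastforce
    moreover have "ln (N d) \<le> 0" using d(2) le_one by simp
    ultimately show "real k + ln (N d) \<le> real (dim_row A)" by linarith
  qed
qed (use assms in blast)

lemma minor_rank_le:
  assumes "\<And>k d. d \<in> minors A k \<Longrightarrow> 0 < N d \<Longrightarrow> real k + ln (N d) \<le> c"
  shows "minor_rank A \<le> c"
  unfolding minor_rank_def
proof (rule cSup_least)
  \<comment> \<open>The empty minor 1 contributes the value 0, so the supremum is over a nonempty
    set.\<close>
  have "1 \<in> minors A 0 \<and> 0 < N 1" by (simp add: minors_0)
  then show "{real k + ln (N d) | k d. d \<in> minors A k \<and> 0 < N d} \<noteq> {}" by blast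
qed (use assms in blast)

lemma minor_rank_nonneg: "0 \<le> minor_rank A"
  using minor_rank_ge[of 1 A 0] by (simp add: minors_0)

lemma minor_rank_transpose: "minor_rank (transpose_mat A) = minor_rank A"
  unfolding minor_rank_def minors_transpose ..

lemma minor_rank_zero: "minor_rank (0\<^sub>m m n) = 0"
proof (rule antisym[OF minor_rank_le minor_rank_nonneg])
  fix k d assume d: "d \<in> minors (0\<^sub>m m n) k" "0 < N d"
  then have "k = 0" using minors_zero_mat[OF d(1)] by (cases k) auto
  then show "real k + ln (N d) \<le> 0" using d by (simp add: minors_0)
qed

text \<open>Only the empty minor and \<open>x\<close> itself compete. The empty one causes the
  truncation at 0, which lets the rank of \<open>x\<close> vanish even when
  \<open>N x > 0\<close>.\<close>

lemma minor_rank_elem_mat: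
  "minor_rank (elem_mat x) = (if 0 < N x then max 0 (1 + ln (N x)) else 0)"
proof (rule antisym)
  show "minor_rank (elem_mat x) \<le> (if 0 < N x then max 0 (1 + ln (N x)) else 0)"
  proof (rule minor_rank_le)
    fix k d assume d: "d \<in> minors (elem_mat x) k" "0 < N d"
    have "k \<le> 1" using minors_large[OF d(1)] d(2) by (fastforce simp: elem_mat_def)
    then consider "k = 0" | "k = 1" by linarith
    then show "real k + ln (N d) \<le> (if 0 < N x then max 0 (1 + ln (N x)) else 0)"
      by cases (use d in \<open>auto simp: minors_0 minors_elem_mat[unfolded One_nat_def]\<close>)
  qed
  show "(if 0 < N x then max 0 (1 + ln (N x)) else 0) \<le> minor_rank (elem_mat x)"
    using minor_rank_nonneg minor_rank_ge[of x "elem_mat x" 1]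
    by (auto simp: minors_elem_mat[unfolded One_nat_def])
qed

lemma minor_rank_mult_right:
  assumes "dim_col A = dim_row B"
  shows "minor_rank (A * B) \<le> minor_rank B"
proof (rule minor_rank_le)
  fix k d assume d: "d \<in> minors (A * B) k" "0 < N d"
  then obtain e where e: "e \<in> minors B k" "N d \<le> N e"
    using minors_mult_le assms by blast
  then have "real k + ln (N d) \<le> real k + ln (N e)" using d(2) by simp
  also have "\<dots> \<le> minor_rank B" using e d(2) by (intro minor_rank_ge) auto
  finally show "real k + ln (N d) \<le> minor_rank B" .
qed

lemma minor_rank_mult_left:
  assumes "dim_col A = dim_row B"
  shows "minor_rank (A * B) \<le> minor_rank A"
proof -
  have "minor_rank (A * B) = minor_rank (transpose_mat B * transpose_mat A)"
    using transpose_mult[of A "dim_row A" "dim_row B" B "dim_col B"] assms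
    by (metis carrier_mat_triv minor_rank_transpose)
  also have "\<dots> \<le> minor_rank (transpose_mat A)"
    using assms by (intro minor_rank_mult_right) simp
  finally show ?thesis by (simp add: minor_rank_transpose)
qed

lemma minor_rank_four_block_mat_ge:
  assumes C: "C \<in> carrier_mat (dim_row A) (dim_col B)"
  shows "minor_rank A + minor_rank B
    \<le> minor_rank (four_block_mat A C (0\<^sub>m (dim_row B) (dim_col A)) B)" (is "_ \<le> ?r")
proof -
  \<comment> \<open>The two suprema are bounded one after the other, with a fixed minor of
    \<open>A\<close> while those of \<open>B\<close> vary.\<close>
  have "minor_rank A \<le> ?r - minor_rank B"
  proof (rule minor_rank_le)
    fix k d assume d: "d \<in> minors A k" "0 < N d"
    have "minor_rank B \<le> ?r - (real k + ln (N d))"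
    proof (rule minor_rank_le)
      fix l e assume e: "e \<in> minors B l" "0 < N e"
      have "real (k + l) + ln (N (d * e)) \<le> ?r"
        using minors_mult_four_block_mat[OF d(1) e(1) C] d(2) e(2)
        by (intro minor_rank_ge) (auto simp: mult)
      then show "real l + ln (N e) \<le> ?r - (real k + ln (N d))"
        using d(2) e(2) by (simp add: mult ln_mult)
    qed
    then show "real k + ln (N d) \<le> ?r - minor_rank B" by linarith
  qed
  then show ?thesis by linarith
qed

text \<open>A nonzero minor of the block-diagonal matrix splits up to sign, the sign is invisible to
  \<open>N\<close>, and \<open>ln\<close> turns the product into a sum.\<close>

lemma minor_rank_block_diagonal_le:
  "minor_rank (four_block_mat A (0\<^sub>m (dim_row A) (dim_col B)) (0\<^sub>m (dim_row B) (dim_col A)) B)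
     \<le> minor_rank A + minor_rank B"
proof (rule minor_rank_le)
  fix k d
  assume d: "d \<in> minors (four_block_mat A (0\<^sub>m (dim_row A) (dim_col B))
      (0\<^sub>m (dim_row B) (dim_col A)) B) k" and pos: "0 < N d"
  from pos have "d \<noteq> 0" by auto
  from d this obtain l m d1 d2 s where *: "k = l + m" "d1 \<in> minors A l" "d2 \<in> minors B m"
    "s = 1 \<or> s = -1" "s * d = d1 * d2"
    by (rule minors_block_diagonal)
  have N: "N d = N d1 * N d2"
    using *(4,5) mult[of d1 d2] by (metis N_minus mult_1 mult_minus1)
  have pos': "0 < N d1" "0 < N d2"
    using N pos nonneg[of d1] nonneg[of d2] by (auto simp: zero_less_mult_iff)
  have "real k + ln (N d) = (real l + ln (N d1)) + (real m + ln (N d2))"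
    using *(1) N pos' by (simp add: ln_mult)
  also have "\<dots> \<le> minor_rank A + minor_rank B"
    using *(2,3) pos' by (intro add_mono minor_rank_ge)
  finally show "real k + ln (N d) \<le> minor_rank A + minor_rank B" .
qed

theorem minor_rank_sylvester: "minor_rank \<in> sylvester_rank_functions"
proof -
  have "minor_rank (four_block_mat A (0\<^sub>m (dim_row A) (dim_col B)) (0\<^sub>m (dim_row B) (dim_col A)) B)
      = minor_rank A + minor_rank B" for A B
    by (intro antisym minor_rank_block_diagonal_le minor_rank_four_block_mat_ge) simp
  moreover have "minor_rank (elem_mat 1) = 1"
    by (simp add: minor_rank_elem_mat)
  ultimately show ?thesis
    unfolding sylvester_rank_functions_def
    by (intro CollectI conjI ballI allI impI Pi_I)
      (simp_all add: minor_rank_nonneg minor_rank_zero minor_rank_mult_left minor_rank_mult_right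
        minor_rank_four_block_mat_ge)
qed

end

section \<open>The range of values\<close>

lemma sylvester_rank_functionsD:
  assumes "rk \<in> sylvester_rank_functions" "A \<in> rect_mats" "B \<in> rect_mats"
  shows "0 \<le> rk A" "rk (elem_mat 1) = 1"
    "dim_col A = dim_row B \<Longrightarrow> rk (A * B) \<le> rk A"
    "dim_col A = dim_row B \<Longrightarrow> rk (A * B) \<le> rk B"
    "rk (four_block_mat A (0\<^sub>m (dim_row A) (dim_col B)) (0\<^sub>m (dim_row B) (dim_col A)) B) = rk A + rk B"
    "C \<in> carrier_mat (dim_row A) (dim_col B) \<Longrightarrow>
      rk A + rk B \<le> rk (four_block_mat A C (0\<^sub>m (dim_row B) (dim_col A)) B)"
proof -
  have "dim_col A = dim_row B \<Longrightarrow> rk (A * B) \<le> min (rk A) (rk B)"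
    using assms unfolding sylvester_rank_functions_def by blast
  then show "dim_col A = dim_row B \<Longrightarrow> rk (A * B) \<le> rk A"
    "dim_col A = dim_row B \<Longrightarrow> rk (A * B) \<le> rk B" by simp_all
  have "rk A \<in> {0..}" using assms unfolding sylvester_rank_functions_def by blast
  then show "0 \<le> rk A" by simp
qed (use assms in \<open>unfold sylvester_rank_functions_def, blast+\<close>)

lemma sylvester_rank_le_half:
  fixes a :: "'a::comm_ring_1"
  assumes rk: "rk \<in> sylvester_rank_functions" and sq: "rk (elem_mat (a ^ 2)) = 0"
  shows "rk (elem_mat a) \<le> 1 / 2"
proof -
  let ?M = "\<lambda>w x y z. four_block_mat (elem_mat w) (elem_mat x) (elem_mat y) (elem_mat z)"
  have [simp]: "elem_mat x \<in> carrier_mat 1 1" "dim_row (elem_mat x) = 1" "dim_col (elem_mat x) = 1"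
    "elem_mat x \<in> rect_mats" for x :: 'a
    by (auto simp: elem_mat_def rect_mats_def)
  have [simp]: "?M w x y z \<in> rect_mats" for w x y z :: 'a
    by (auto simp: rect_mats_def)
  have zero: "0\<^sub>m 1 1 = elem_mat (0 :: 'a)"
    by (intro eq_matI) (auto simp: elem_mat_def)
  have mult: "?M w x y z * ?M w' x' y' z'
      = ?M (w * w' + x * y') (w * x' + x * z') (y * w' + z * y') (y * x' + z * z')"
    for w x y z w' x' y' z' :: 'a
  proof -
    have *: "elem_mat (b :: 'a) * elem_mat c + elem_mat d * elem_mat e = elem_mat (b * c + d * e)"
      for b c d e by (intro eq_matI) (auto simp: elem_mat_def scalar_prod_def)
    show ?thesis by (subst mult_four_block_mat[of _ 1 1 _ 1 _ 1 _ _ 1 _ 1]) (auto simp: *)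
  qed
  note D = sylvester_rank_functionsD[OF rk]
  have "rk (elem_mat a) + rk (elem_mat a) \<le> rk (?M a 1 0 a)"
    using D(6)[of "elem_mat a" "elem_mat a" "elem_mat 1"] by (simp del: One_nat_def add: zero[symmetric])
  \<comment> \<open>Elimination with the upper right entry 1 as pivot; both outer factors have
    determinant 1.\<close>
  also have "?M a 1 0 a = ?M 1 0 a 1 * (?M 1 0 0 (a ^ 2) * ?M a 1 (- 1) 0)"
    by (simp add: mult power2_eq_square)
  also have "rk \<dots> \<le> rk (?M 1 0 0 (a ^ 2) * ?M a 1 (- 1) 0)"
    by (intro D(4)) (simp_all add: mult)
  also have "\<dots> \<le> rk (?M 1 0 0 (a ^ 2))"
    by (intro D(3)) simp_all
  also have "\<dots> = rk (elem_mat 1) + rk (elem_mat (a ^ 2))"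
    using D(5)[of "elem_mat 1" "elem_mat (a ^ 2)"] by (simp del: One_nat_def add: zero[symmetric])
  also have "\<dots> = 1"
    using D(2)[of "elem_mat a" "elem_mat a"] sq by simp
  finally show ?thesis by simp
qed

theorem theorem4p5:
  fixes a :: "'a::comm_ring_1"
  assumes "\<And>n::nat. a ^ n \<notin> {r * a ^ (n + 1) | r. r \<in> UNIV}"
  shows "{rk (elem_mat a) | rk. rk \<in> sylvester_rank_functions \<and> rk (elem_mat (a ^ 2)) = 0}
           = {0..1/2 :: real}"
proof (intro equalityI subsetI)
  fix t assume "t \<in> {rk (elem_mat a) | rk. rk \<in> sylvester_rank_functions \<and> rk (elem_mat (a ^ 2)) = 0}"
  then obtain rk where rk: "t = rk (elem_mat a)" "rk \<in> sylvester_rank_functions"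
    "rk (elem_mat (a ^ 2)) = 0" by blast
  have "elem_mat a \<in> rect_mats" by (simp add: elem_mat_def rect_mats_def)
  then have "0 \<le> t" using rk(1) sylvester_rank_functionsD(1)[OF rk(2)] by simp
  then show "t \<in> {0..1/2}" using sylvester_rank_le_half[OF rk(2,3)] rk(1) by simp
next
  fix t :: real assume t: "t \<in> {0..1/2}"
  have "\<not> a ^ (n + 1) dvd a ^ n" for n
  proof
    assume "a ^ (n + 1) dvd a ^ n"
    then obtain r where "a ^ n = a ^ (n + 1) * r" by (rule dvdE)
    then show False using assms[of n] by (auto simp: mult.commute)
  qed
  \<comment> \<open>The value \<open>exp (t - 1)\<close> makes \<open>1 + ln (N a) = t\<close>. It
    lies strictly between 0 and 1 because \<open>t < 1\<close>. For \<open>a ^ 2\<close> the same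
    expression is \<open>2 * t - 1\<close>, which is truncated to 0 because
    \<open>t \<le> 1/2\<close>.\<close>
  then obtain N where N: "multiplicative_seminorm N" "N a = exp (t - 1)"
    using exists_multiplicative_seminorm[of a "exp (t - 1)"] t by auto
  interpret multiplicative_seminorm N by (rule N(1))
  have "minor_rank (elem_mat a) = t"
    using t N(2) by (simp add: minor_rank_elem_mat)
  moreover have "minor_rank (elem_mat (a ^ 2)) = 0"
    using t N(2) by (simp add: minor_rank_elem_mat power2_eq_square mult ln_mult)
  ultimately show "t \<in> {rk (elem_mat a) | rk. rk \<in> sylvester_rank_functions \<and> rk (elem_mat (a ^ 2)) = 0}"
    using minor_rank_sylvester by blast
qed

end
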